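(* There exists $n_0$ such that the following holds for all integers $n\geq n_0$, all integers $k$ with $n^{1/3}\leq k\leq n$, and all symmetric positive semidefinite matrices $M\in\mathbb{R}^{n\times n}$ (with entries of arbitrary sign). Let $$\mathcal{D}_k(M)=\max_{u\in\{0,1\}^n,\ \mathbf{1}^Tu\leq k}u^TMu,$$ let $SDP_k(M)$ be the optimal value of the semidefinite program $$\text{maximize }\operatorname{Tr}(MX)\quad\text{subject to}\quad 0\leq X_{ij}\leq 1\ (i,j=1,\ldots,n),\quad \operatorname{Tr}X=k,\quad X\succeq 0,$$ in the symmetric variable $X\in\mathbb{R}^{n\times n}$, let $X$ be an optimal solution of this program, and let $G\in\mathbb{R}^{n\times n}$ be given by $G_{ij}=\sqrt{X_{ii}X_{jj}}$. Then $$\frac{k}{n}\,\mu(n,k)\left(\frac14\operatorname{Tr}(MG)+\frac{1}{2\pi}SDP_k(M)\right)\leq\mathcal{D}_k(M)\leq SDP_k(M),$$ where $$\mu(n,k)=\left(1-\frac{2}{k^{1/3}}\right)\left(\frac{1}{1-\frac{2\pi n^2}{k^2}e^{-\frac{n^{1/9}}{3}}}\right)\xrightarrow[n\to\infty]{}1,$$ and in particular $\operatorname{Tr}(MG)\geq 0$.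
   Context: $\mathbf{1}$ is the all-ones vector; $X\succeq 0$ means $X$ is positive semidefinite. *)

theory Defs
  imports Complex_Main "Jordan_Normal_Form.Matrix"
begin

text \<open>
  Real matrices of arbitrary size are values of the type \<^typ>\<open>real mat\<close>, with rows and
  columns indexed from 0, because the dimension \<open>n\<close> is quantified inside the theorem.
\<close>

definition trace_mat :: "real mat \<Rightarrow> real" where
  "trace_mat A = (\<Sum>i<dim_row A. A $$ (i, i))"

text \<open>Symmetry is part of the notion \<open>X \<succeq> 0\<close>.\<close>

definition psd_mat :: "nat \<Rightarrow> real mat \<Rightarrow> bool" where
  "psd_mat n A \<longleftrightarrow> A \<in> carrier_mat n n \<and> transpose_mat A = A \<and>
     (\<forall>v\<in>carrier_vec n. v \<bullet> (A *\<^sub>v v) \<ge> 0)"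

definition ones_vec :: "nat \<Rightarrow> real vec" where
  "ones_vec n = vec n (\<lambda>_. 1)"

definition zero_one_vecs :: "nat \<Rightarrow> nat \<Rightarrow> real vec set" where
  "zero_one_vecs n k = {u \<in> carrier_vec n. (\<forall>i<n. u $ i \<in> {0, 1}) \<and> ones_vec n \<bullet> u \<le> real k}"

text \<open>The set of values is finite and nonempty, so \<^const>\<open>Max\<close> is the true maximum.\<close>

definition D_max :: "nat \<Rightarrow> nat \<Rightarrow> real mat \<Rightarrow> real" where
  "D_max n k M = Max ((\<lambda>u. u \<bullet> (M *\<^sub>v u)) ` zero_one_vecs n k)"

definition sdp_feasible :: "nat \<Rightarrow> nat \<Rightarrow> real mat set" where
  "sdp_feasible n k = {X. psd_mat n X \<and> (\<forall>i<n. \<forall>j<n. 0 \<le> X $$ (i, j) \<and> X $$ (i, j) \<le> 1) \<and>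
     trace_mat X = real k}"

text \<open>
  For \<open>1 \<le> k \<le> n\<close> the feasible set is nonempty (it contains \<open>(k/n) I\<close>) and compact, so the
  supremum below is a genuine one and is attained.
\<close>

definition sdp_value :: "nat \<Rightarrow> nat \<Rightarrow> real mat \<Rightarrow> real" where
  "sdp_value n k M = (SUP X\<in>sdp_feasible n k. trace_mat (M * X))"

definition sdp_optimal :: "nat \<Rightarrow> nat \<Rightarrow> real mat \<Rightarrow> real mat \<Rightarrow> bool" where
  "sdp_optimal n k M X \<longleftrightarrow> X \<in> sdp_feasible n k \<and>
     (\<forall>Y\<in>sdp_feasible n k. trace_mat (M * Y) \<le> trace_mat (M * X))"

definition sqrt_diag_mat :: "nat \<Rightarrow> real mat \<Rightarrow> real mat" where
  "sqrt_diag_mat n X = mat n n (\<lambda>(i, j). sqrt (X $$ (i, i) * X $$ (j, j)))"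

definition mu :: "nat \<Rightarrow> nat \<Rightarrow> real" where
  "mu n k = (1 - 2 / real k powr (1/3)) *
     (1 / (1 - 2 * pi * (real n)\<^sup>2 / (real k)\<^sup>2 * exp (- (real n powr (1/9)) / 3)))"

end

(*
Write X as a Gram matrix of vectors x_i with |x_i|^2 = X_ii = d_i^2, take a standard Gaussian g and
put y_i = <g, x_i>, c = sqrt (2/pi). With the signs s_i of (M y)_i, convexity of the form M gives
(ds)^T M (ds) >= 2c (ds)^T M y - c^2 y^T M y = 2c sum_i d_i |(M y)_i| - c^2 y^T M y. Since
E|<g, a>| = c |a|, the expectation of the right-hand side is, by Cauchy-Schwarz, at least
2c^2 Tr(M X) - c^2 Tr(M X) = (2/pi) Tr(M X), so some fixed s does as well.

With delta = k^(-1/3) the vectors p = (1 - delta) sqrt(k/n) d (1 + s)/2 and the same with -s have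
entries in [0,1] and sums at most (1 - delta) k. Include each i independently with probability
p_i: by Jensen the expected value of the form on the resulting 0/1 vector is at least its value
at p. A set S with |S| <= k gives at most the combinatorial optimum, and any larger one at most n/k
times the value of the program (k/|S| times the rank-one matrix of S is feasible), which by Chernoff
occurs with probability at most exp (-k^(1/3) / 4). Averaging over s and -s
yields Tr(M G) together with (2/pi) Tr(M X).
*)
theory Submission
  imports "HOL-Probability.Probability" "HOL-Real_Asymp.Real_Asymp" Defs
begin

section \<open>Positive semidefinite forms\<close>

text \<open>Matrices and vectors are plain functions of which only the values below \<open>n\<close>
  matter, so that vectors can be added and scaled without carrier conditions;
  \<open>real mat\<close> reappears only at the semidefinite program.\<close>

definition bform :: "nat \<Rightarrow> (nat \<Rightarrow> nat \<Rightarrow> real) \<Rightarrow> (nat \<Rightarrow> real) \<Rightarrow> (nat \<Rightarrow> real) \<Rightarrow> real" where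
  "bform n M u v = (\<Sum>i<n. \<Sum>j<n. M i j * u i * v j)"

definition psd_form :: "nat \<Rightarrow> (nat \<Rightarrow> nat \<Rightarrow> real) \<Rightarrow> bool" where
  "psd_form n M \<longleftrightarrow> (\<forall>i<n. \<forall>j<n. M i j = M j i) \<and> (\<forall>v. 0 \<le> bform n M v v)"

lemma psd_form_sym: "psd_form n M \<Longrightarrow> i < n \<Longrightarrow> j < n \<Longrightarrow> M i j = M j i"
  and psd_form_nonneg: "psd_form n M \<Longrightarrow> 0 \<le> bform n M v v"
  by (auto simp: psd_form_def)

lemma bform_cong:
  "(\<And>i j. i < n \<Longrightarrow> j < n \<Longrightarrow> M i j = M' i j) \<Longrightarrow> (\<And>i. i < n \<Longrightarrow> u i = u' i) \<Longrightarrow>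
    (\<And>i. i < n \<Longrightarrow> v i = v' i) \<Longrightarrow> bform n M u v = bform n M' u' v'"
  by (auto simp: bform_def intro!: sum.cong)

lemma bform_add_left: "bform n M (\<lambda>i. u i + u' i) v = bform n M u v + bform n M u' v"
  and bform_add_right: "bform n M u (\<lambda>i. v i + v' i) = bform n M u v + bform n M u v'"
  and bform_scale_left: "bform n M (\<lambda>i. c * u i) v = c * bform n M u v"
  and bform_scale_right: "bform n M u (\<lambda>i. c * v i) = c * bform n M u v"
  by (simp_all add: bform_def algebra_simps sum.distrib sum_distrib_left)

lemma bform_commute:
  assumes "psd_form n M"
  shows "bform n M u v = bform n M v u"
  unfolding bform_def
  by (subst sum.swap) (auto intro!: sum.cong simp: psd_form_sym[OF assms])

lemma bform_add_self:
  assumes "psd_form n M"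
  shows "bform n M (\<lambda>i. u i + c * v i) (\<lambda>i. u i + c * v i)
    = bform n M u u + 2 * c * bform n M u v + c\<^sup>2 * bform n M v v"
  by (simp add: bform_add_left bform_add_right bform_scale_left bform_scale_right
      bform_commute[OF assms, of v u] power2_eq_square algebra_simps)

text \<open>Nonnegativity of the form at \<open>u - c v\<close>: the quadratic lies above its
  tangent. The lower bound is affine in \<open>u\<close>, so it can be averaged knowing only the
  mean of \<open>u\<close>, and it can be made explicit for a Gaussian \<open>v\<close>.\<close>

lemma bform_linear_lower_bound:
  assumes "psd_form n M"
  shows "2 * c * bform n M u v - c\<^sup>2 * bform n M v v \<le> bform n M u u"
  using psd_form_nonneg[OF assms, of "\<lambda>i. u i + (- c) * v i"]
  by (subst (asm) bform_add_self[OF assms]) simp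

section \<open>Unit vectors, Schur complements and Gram factorisation\<close>

lemma bform_unit:
  assumes "i < n" "j < n"
  shows "bform n M (\<lambda>l. of_bool (l = i)) (\<lambda>l. of_bool (l = j)) = M i j"
proof -
  have "M a b * of_bool (a = i) * of_bool (b = j)
      = (if b = j then (if a = i then M i j else 0) else 0)" for a b
    by simp
  then show ?thesis unfolding bform_def using assms by (simp only: sum.delta finite_lessThan lessThan_iff if_True)
qed

lemma psd_form_diag_nonneg: "psd_form n M \<Longrightarrow> i < n \<Longrightarrow> 0 \<le> M i i"
  using psd_form_nonneg[of n M "\<lambda>l. of_bool (l = i)"] by (simp add: bform_unit)

text \<open>Along \<open>e_i + t e_j\<close> the form has no quadratic term in \<open>t\<close>, so
  a nonzero slope would make it negative somewhere; the \<open>t\<close> chosen below gives the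
  value -1.\<close>

lemma psd_form_zero_diag:
  assumes "psd_form n M" "i < n" "j < n" "M j j = 0"
  shows "M i j = 0"
proof (rule ccontr)
  assume nz: "M i j \<noteq> 0"
  define t where "t = - (M i i + 1) / (2 * M i j)"
  have "0 \<le> M i i + 2 * t * M i j"
    using psd_form_nonneg[OF assms(1), of "\<lambda>l. of_bool (l = i) + t * of_bool (l = j)"] assms
    by (subst (asm) bform_add_self) (simp_all add: bform_unit)
  moreover have "2 * t * M i j = - (M i i + 1)" using nz by (simp add: t_def)
  ultimately show False by simp
qed

text \<open>
  If \<open>M n n = 0\<close>, division by zero turns the Schur complement into the restriction
  of \<open>M\<close> and the new entry of \<open>v\<close> into \<open>0\<close>, so no case distinction is needed.
\<close>

lemma bform_Suc_schur:
  assumes "psd_form (Suc n) M"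
  shows "bform n (\<lambda>i j. M i j - M i n * M j n / M n n) v v
    = bform (Suc n) M (v(n := - (\<Sum>i<n. M i n * v i) / M n n)) (v(n := - (\<Sum>i<n. M i n * v i) / M n n))"
proof -
  define a where "a = (\<Sum>i<n. M i n * v i)"
  \<comment> \<open>For \<open>M n n > 0\<close> this is the last coordinate that minimises the form
    once \<open>v\<close> is fixed; the minimum is the Schur complement.\<close>
  define w where "w = - a / M n n"
  have swap: "M n i = M i n" if "i < n" for i
    using psd_form_sym[OF assms] that by simp
  have "bform (Suc n) M (v(n := w)) (v(n := w))
      = bform n M v v + (\<Sum>i<n. M i n * v i * w) + (\<Sum>j<n. M n j * w * v j) + M n n * w * w"
    by (simp add: bform_def sum.distrib)
  also have "(\<Sum>i<n. M i n * v i * w) = a * w"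
    by (simp add: a_def sum_distrib_right)
  also have "(\<Sum>j<n. M n j * w * v j) = a * w"
    by (auto simp add: a_def sum_distrib_right swap intro!: sum.cong)
  also have "bform n M v v + a * w + a * w + M n n * w * w = bform n M v v - a * a / M n n"
    by (cases "M n n = 0") (simp_all add: w_def field_simps)
  also have "a * a / M n n = (\<Sum>i<n. \<Sum>j<n. M i n * M j n / M n n * v i * v j)"
    by (simp add: a_def sum_product sum_divide_distrib mult_ac)
  also have "bform n M v v - (\<Sum>i<n. \<Sum>j<n. M i n * M j n / M n n * v i * v j)
      = bform n (\<lambda>i j. M i j - M i n * M j n / M n n) v v"
    by (simp add: bform_def sum_subtractf[symmetric] left_diff_distrib)
  finally show ?thesis unfolding w_def a_def ..
qed

text \<open>Cholesky factorisation by elimination of the last index: Gram vectors of the Schur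
  complement receive one more coordinate, which accounts for the subtracted rank-one term.\<close>

lemma psd_form_gram:
  assumes "psd_form n M"
  shows "\<exists>L. \<forall>i<n. \<forall>j<n. M i j = (\<Sum>l<n. L i l * L j l)"
  using assms
proof (induction n arbitrary: M)
  case 0
  then show ?case by simp
next
  case (Suc n)
  note sym = psd_form_sym[OF Suc.prems]
  define M' where "M' = (\<lambda>i j. M i j - M i n * M j n / M n n)"
  have "psd_form n M'"
    unfolding psd_form_def M'_def bform_Suc_schur[OF Suc.prems]
    using psd_form_nonneg[OF Suc.prems] sym by auto
  from Suc.IH[OF this] obtain L where
    L: "\<And>i j. i < n \<Longrightarrow> j < n \<Longrightarrow> M' i j = (\<Sum>l<n. L i l * L j l)" by blast
  \<comment> \<open>The Schur complement vanishes in row and column \<open>n\<close>, hence the new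
    vector \<open>K n\<close> is zero in all old coordinates.\<close>
  define K where "K = (\<lambda>i l. if l = n then M i n / sqrt (M n n) else if i < n then L i l else 0)"
  have nn: "0 \<le> M n n" using psd_form_diag_nonneg[OF Suc.prems] by simp
  have last: "K i n * K j n = M i n * M j n / M n n" for i j
    using nn by (simp add: K_def)
  \<comment> \<open>A zero pivot forces the whole column to vanish, so the convention x / 0 = 0
    gives the right entry there.\<close>
  have col: "M i n * M n n / M n n = M i n" if "i \<le> n" for i
    using psd_form_zero_diag[OF Suc.prems, of i n] that by (cases "M n n = 0") auto
  have "M i j = (\<Sum>l<Suc n. K i l * K j l)" if ij: "i < Suc n" "j < Suc n" for i j
  proof (cases "i < n \<and> j < n")
    case True
    then have "(\<Sum>l<n. K i l * K j l) = M' i j"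
      using L by (auto simp: K_def intro!: sum.cong)
    then show ?thesis by (simp add: last M'_def)
  next
    case False
    then have "(\<Sum>l<n. K i l * K j l) = 0"
      by (auto simp: K_def intro!: sum.neutral)
    moreover have "M i n * M j n / M n n = M i j"
      using False ij col[of i] col[of j] sym[of n j] by (auto simp: less_Suc_eq mult.commute)
    ultimately show ?thesis by (simp add: last)
  qed
  then show ?case by blast
qed

section \<open>Random subsets\<close>

text \<open>
  The probability of \<open>S\<close> when each \<open>i < n\<close> is included independently with probability \<open>p i\<close>.
\<close>

definition subset_weight :: "nat \<Rightarrow> (nat \<Rightarrow> real) \<Rightarrow> nat set \<Rightarrow> real" where
  "subset_weight n p S = (\<Prod>i\<in>S. p i) * (\<Prod>i\<in>{..<n} - S. 1 - p i)"

text \<open>Expanding the product over \<open>i\<close> chooses one summand for each index, i.e. a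
  subset. Total mass, marginals and exponential moments all follow by choosing \<open>f\<close> and
  \<open>g\<close>.\<close>

lemma subset_weight_prod:
  "(\<Sum>S\<in>Pow {..<n}. subset_weight n p S * (\<Prod>i\<in>S. f i) * (\<Prod>i\<in>{..<n} - S. g i))
    = (\<Prod>i<n. p i * f i + (1 - p i) * g i)"
  by (subst prod_add) (simp_all add: subset_weight_def prod.distrib mult_ac)

lemma subset_weight_nonneg:
  assumes "\<And>i. i < n \<Longrightarrow> 0 \<le> p i \<and> p i \<le> 1" "S \<subseteq> {..<n}"
  shows "0 \<le> subset_weight n p S"
  unfolding subset_weight_def using assms by (intro mult_nonneg_nonneg prod_nonneg) auto

lemma subset_weight_total: "(\<Sum>S\<in>Pow {..<n}. subset_weight n p S) = 1"
  using subset_weight_prod[of n p "\<lambda>_. 1" "\<lambda>_. 1"] by simp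

lemma subset_weight_marginal:
  assumes "j < n"
  shows "(\<Sum>S\<in>Pow {..<n}. subset_weight n p S * of_bool (j \<in> S)) = p j"
proof -
  \<comment> \<open>A factor on the complement of \<open>S\<close> that vanishes only at
    \<open>j\<close> kills exactly the sets missing \<open>j\<close>.\<close>
  have "(\<Sum>S\<in>Pow {..<n}. subset_weight n p S * of_bool (j \<in> S)) =
      (\<Sum>S\<in>Pow {..<n}. subset_weight n p S * (\<Prod>i\<in>S. 1) * (\<Prod>i\<in>{..<n} - S. of_bool (i \<noteq> j)))"
  proof (rule sum.cong)
    fix S assume "S \<in> Pow {..<n}"
    have "(\<Prod>i\<in>{..<n} - S. of_bool (i \<noteq> j)) = (of_bool (j \<in> S) :: real)"
      using assms by (cases "j \<in> S") (auto intro!: prod.neutral)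
    then show "subset_weight n p S * of_bool (j \<in> S) =
      subset_weight n p S * (\<Prod>i\<in>S. 1) * (\<Prod>i\<in>{..<n} - S. of_bool (i \<noteq> j))" by simp
  qed simp
  also have "\<dots> = (\<Prod>i<n. if i = j then p i else 1)"
    unfolding subset_weight_prod by (rule prod.cong) auto
  also have "\<dots> = p j" using assms by simp
  finally show ?thesis .
qed

lemma subset_weight_exp:
  fixes t :: real
  shows "(\<Sum>S\<in>Pow {..<n}. subset_weight n p S * exp (t * card S)) = (\<Prod>i<n. 1 + p i * (exp t - 1))"
proof -
  have "exp (t * card S) = exp t ^ card S" for S :: "nat set"
    by (metis exp_of_nat_mult mult.commute)
  then have "(\<Sum>S\<in>Pow {..<n}. subset_weight n p S * exp (t * card S))
      = (\<Sum>S\<in>Pow {..<n}. subset_weight n p S * (\<Prod>i\<in>S. exp t) * (\<Prod>i\<in>{..<n} - S. 1))"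
    by (intro sum.cong) simp_all
  also have "\<dots> = (\<Prod>i<n. 1 + p i * (exp t - 1))"
    unfolding subset_weight_prod by (simp add: algebra_simps)
  finally show ?thesis .
qed

text \<open>Chernoff bound through Markov's inequality for \<open>exp (t * card S)\<close>, with
  \<open>1 + x \<le> exp x\<close> in each factor and the quadratic estimate of
  \<open>exp t - 1\<close> on [0, 1].\<close>

lemma subset_weight_tail:
  assumes p: "\<And>i. i < n \<Longrightarrow> 0 \<le> p i \<and> p i \<le> 1"
    and sum_p: "(\<Sum>i<n. p i) \<le> (1 - \<delta>) * k" and \<delta>: "0 \<le> \<delta>" "\<delta> \<le> 1" and "0 \<le> k"
  shows "(\<Sum>S\<in>Pow {..<n}. subset_weight n p S * of_bool (k < card S)) \<le> exp (- \<delta>\<^sup>2 * k / 4)"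
proof -
  \<comment> \<open>Per unit of \<open>k\<close> the exponent is
    \<open>(1 - \<delta>) * (t + t\<^sup>2) - t\<close>, which is
    \<open>t\<^sup>2 - \<delta> * t\<close> up to a nonpositive term; this \<open>t\<close>
    minimises the latter, with value \<open>- \<delta>\<^sup>2 / 4\<close>.\<close>
  define t where "t = \<delta> / 2"
  have t: "0 \<le> t" "t \<le> 1" using \<delta> by (simp_all add: t_def)
  have "(\<Sum>S\<in>Pow {..<n}. subset_weight n p S * of_bool (k < card S))
      \<le> (\<Sum>S\<in>Pow {..<n}. subset_weight n p S * exp (t * card S) * exp (- t * k))"
  proof (rule sum_mono)
    fix S assume "S \<in> Pow {..<n}"
    then have "0 \<le> subset_weight n p S" using subset_weight_nonneg[of n p] p by blast
    moreover have "of_bool (k < card S) \<le> exp (t * card S) * exp (- t * k)"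
    proof (cases "k < card S")
      case True
      then have "0 \<le> t * (card S - k)" using t by simp
      then have "1 \<le> exp (t * (card S - k))" by simp
      then show ?thesis using True by (simp add: mult_exp_exp algebra_simps)
    qed simp
    ultimately show "subset_weight n p S * of_bool (k < card S)
        \<le> subset_weight n p S * exp (t * card S) * exp (- t * k)"
      unfolding mult.assoc by (rule mult_left_mono[rotated])
  qed
  also have "\<dots> = (\<Prod>i<n. 1 + p i * (exp t - 1)) * exp (- t * k)"
    unfolding subset_weight_exp[symmetric] sum_distrib_right ..
  also have "(\<Prod>i<n. 1 + p i * (exp t - 1)) \<le> (\<Prod>i<n. exp (p i * (exp t - 1)))"
    using p t by (intro prod_mono conjI exp_ge_add_one_self) auto
  also have "\<dots> = exp ((\<Sum>i<n. p i) * (exp t - 1))"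
    by (simp add: exp_sum sum_distrib_right)
  also have "\<dots> \<le> exp ((1 - \<delta>) * k * (t + t\<^sup>2))"
  proof -
    have "exp t - 1 \<le> t + t\<^sup>2" using exp_bound[of t] t by simp
    moreover have "0 \<le> (\<Sum>i<n. p i)" using p by (intro sum_nonneg) auto
    ultimately have "(\<Sum>i<n. p i) * (exp t - 1) \<le> (1 - \<delta>) * k * (t + t\<^sup>2)"
      using sum_p t by (intro mult_mono) auto
    then show ?thesis by simp
  qed
  also have "exp ((1 - \<delta>) * k * (t + t\<^sup>2)) * exp (- t * k) \<le> exp (- \<delta>\<^sup>2 * k / 4)"
  proof -
    have "(1 - \<delta>) * k * (t + t\<^sup>2) + - t * k = - \<delta>\<^sup>2 * k / 4 - 2 * t * t\<^sup>2 * k"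
      by (simp add: t_def power2_eq_square field_simps)
    moreover have "0 \<le> 2 * t * t\<^sup>2 * k" using t \<open>0 \<le> k\<close> by simp
    ultimately have "(1 - \<delta>) * k * (t + t\<^sup>2) + - t * k \<le> - \<delta>\<^sup>2 * k / 4" by linarith
    then show ?thesis by (simp add: mult_exp_exp)
  qed
  finally show ?thesis by simp
qed

text \<open>
  Jensen's inequality: averaging the lower bound that is linear in the indicator of \<open>S\<close>
  only uses the marginals \<open>p i\<close>.
\<close>

lemma bform_le_subset_average:
  assumes "psd_form n M" and p: "\<And>i. i < n \<Longrightarrow> 0 \<le> p i \<and> p i \<le> 1"
  shows "bform n M p p
    \<le> (\<Sum>S\<in>Pow {..<n}. subset_weight n p S * bform n M (\<lambda>i. of_bool (i \<in> S)) (\<lambda>i. of_bool (i \<in> S)))"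
proof -
  let ?w = "subset_weight n p"
  let ?e = "\<lambda>S i. of_bool (i \<in> S)"
  have "(\<Sum>S\<in>Pow {..<n}. ?w S * bform n M (?e S) p)
      = (\<Sum>S\<in>Pow {..<n}. \<Sum>i<n. \<Sum>j<n. M i j * (?w S * ?e S i) * p j)"
    by (simp add: bform_def sum_distrib_left mult_ac)
  also have "\<dots> = (\<Sum>i<n. \<Sum>j<n. \<Sum>S\<in>Pow {..<n}. M i j * (?w S * ?e S i) * p j)"
    by (subst sum.swap, rule sum.cong, simp, rule sum.swap)
  also have "\<dots> = (\<Sum>i<n. \<Sum>j<n. M i j * (\<Sum>S\<in>Pow {..<n}. ?w S * ?e S i) * p j)"
    unfolding sum_distrib_left sum_distrib_right ..
  also have "\<dots> = bform n M p p"
    by (simp add: subset_weight_marginal bform_def del: sum_mult_of_bool_eq)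
  finally have mean: "(\<Sum>S\<in>Pow {..<n}. ?w S * bform n M (?e S) p) = bform n M p p" .
  have "bform n M p p = 2 * bform n M p p - 1 * bform n M p p" by simp
  also have "\<dots> = (\<Sum>S\<in>Pow {..<n}. ?w S * (2 * bform n M (?e S) p - bform n M p p))"
  proof -
    have "(\<Sum>S\<in>Pow {..<n}. ?w S * (2 * bform n M (?e S) p - bform n M p p))
        = 2 * (\<Sum>S\<in>Pow {..<n}. ?w S * bform n M (?e S) p) - (\<Sum>S\<in>Pow {..<n}. ?w S) * bform n M p p"
      by (simp only: right_diff_distrib sum_subtractf sum_distrib_left sum_distrib_right
          mult.left_commute[of _ 2])
    then show ?thesis by (simp only: mean subset_weight_total)
  qed
  also have "\<dots> \<le> (\<Sum>S\<in>Pow {..<n}. ?w S * bform n M (?e S) (?e S))"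
    using subset_weight_nonneg[of n p] p bform_linear_lower_bound[OF assms(1), of 1]
    by (intro sum_mono mult_left_mono) auto
  finally show ?thesis .
qed

text \<open>Convexity makes randomised rounding gain on average. Sets within the budget contribute
  at most \<open>D\<close>; those above it may reach \<open>W\<close>, but their total weight is
  exponentially small.\<close>

lemma bform_rounding:
  fixes k :: nat and p :: "nat \<Rightarrow> real" and \<delta> :: real
  assumes M: "psd_form n M" and p: "\<And>i. i < n \<Longrightarrow> 0 \<le> p i \<and> p i \<le> 1"
    and sum_p: "(\<Sum>i<n. p i) \<le> (1 - \<delta>) * k" and \<delta>: "0 \<le> \<delta>" "\<delta> \<le> 1"
    and D: "\<And>S. S \<subseteq> {..<n} \<Longrightarrow> card S \<le> k \<Longrightarrow>
      bform n M (\<lambda>i. of_bool (i \<in> S)) (\<lambda>i. of_bool (i \<in> S)) \<le> D"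
    and W: "\<And>S. S \<subseteq> {..<n} \<Longrightarrow> k < card S \<Longrightarrow>
      bform n M (\<lambda>i. of_bool (i \<in> S)) (\<lambda>i. of_bool (i \<in> S)) \<le> W"
    and "0 \<le> W"
  shows "bform n M p p \<le> D + exp (- \<delta>\<^sup>2 * k / 4) * W"
proof -
  let ?w = "subset_weight n p"
  \<comment> \<open>The empty set gives this; it makes \<open>D + W\<close> a valid bound for
    oversized sets.\<close>
  have "0 \<le> D" using D[of "{}"] by (simp add: bform_def)
  have "bform n M p p
      \<le> (\<Sum>S\<in>Pow {..<n}. ?w S * bform n M (\<lambda>i. of_bool (i \<in> S)) (\<lambda>i. of_bool (i \<in> S)))"
    using bform_le_subset_average[OF M p] .
  also have "\<dots> \<le> (\<Sum>S\<in>Pow {..<n}. ?w S * (D + of_bool (k < card S) * W))"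
  proof (intro sum_mono mult_left_mono)
    fix S assume S: "S \<in> Pow {..<n}"
    show "0 \<le> ?w S" using subset_weight_nonneg[of n p S] p S by blast
    show "bform n M (\<lambda>i. of_bool (i \<in> S)) (\<lambda>i. of_bool (i \<in> S)) \<le> D + of_bool (k < card S) * W"
      using D[of S] W[of S] S \<open>0 \<le> D\<close> by (cases "k < card S") force+
  qed
  also have "\<dots> = D * (\<Sum>S\<in>Pow {..<n}. ?w S) + W * (\<Sum>S\<in>Pow {..<n}. ?w S * of_bool (k < card S))"
    by (simp add: distrib_left sum.distrib sum_distrib_left mult_ac
        del: sum_mult_of_bool_eq sum_of_bool_mult_eq)
  also have "\<dots> \<le> D + W * exp (- \<delta>\<^sup>2 * k / 4)"
    using subset_weight_tail[OF p sum_p \<delta>] \<open>0 \<le> W\<close>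
    by (simp add: subset_weight_total mult_left_mono del: sum_mult_of_bool_eq)
  finally show ?thesis by (simp add: mult.commute)
qed

section \<open>Gaussian vectors\<close>

text \<open>\<open>n\<close> coordinates suffice because the vectors supplied by
  \<open>psd_form_gram\<close> have \<open>n\<close> entries.\<close>

definition gauss_space :: "nat \<Rightarrow> (nat \<Rightarrow> real) measure" where
  "gauss_space n = (\<Pi>\<^sub>M i\<in>{..<n}. density lborel std_normal_density)"

lemma prob_space_gauss_space: "prob_space (gauss_space n)"
  unfolding gauss_space_def by (intro prob_space_PiM prob_space_normal_density) simp

lemma measurable_gauss_component:
  assumes "i < n"
  shows "(\<lambda>g. g i) \<in> borel_measurable (gauss_space n)"
proof -
  have "(\<lambda>g. g i) \<in> measurable (gauss_space n) (density lborel std_normal_density)"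
    unfolding gauss_space_def using assms by (intro measurable_component_singleton) simp
  then show ?thesis by simp
qed

lemma distr_gauss_component:
  assumes "i < n"
  shows "distr (gauss_space n) borel (\<lambda>g. g i) = density lborel std_normal_density"
proof -
  have "distr (gauss_space n) (density lborel std_normal_density) (\<lambda>g. g i) = density lborel std_normal_density"
    unfolding gauss_space_def using assms
    by (intro distr_PiM_component prob_space_normal_density) auto
  moreover have "distr (gauss_space n) borel (\<lambda>g. g i)
      = distr (gauss_space n) (density lborel std_normal_density) (\<lambda>g. g i)"
    by (rule distr_cong) auto
  ultimately show ?thesis by simp
qed

lemma distributed_gauss_component:
  assumes "i < n"
  shows "distributed (gauss_space n) lborel (\<lambda>g. g i) std_normal_density"
proof -
  have "distr (gauss_space n) lborel (\<lambda>g. g i) = distr (gauss_space n) borel (\<lambda>g. g i)"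
    by (rule distr_cong) auto
  then show ?thesis
    using measurable_gauss_component[OF assms] distr_gauss_component[OF assms]
    by (simp add: distributed_def)
qed

lemma indep_vars_gauss_components:
  shows "prob_space.indep_vars (gauss_space n) (\<lambda>_. borel) (\<lambda>i g. g i) {..<n}"
\<comment> \<open>The criterion by product laws applied below asks for a nonempty index set.\<close>
proof (cases "n = 0")
  case True
  then show ?thesis
    by (simp add: prob_space.indep_vars_def[OF prob_space_gauss_space]
        prob_space.indep_sets_def[OF prob_space_gauss_space])
next
  case False
  have sets: "sets (gauss_space n) = sets (\<Pi>\<^sub>M i\<in>{..<n}. (borel :: real measure))"
    unfolding gauss_space_def by (intro sets_PiM_cong) auto
  \<comment> \<open>Points of \<open>gauss_space n\<close> are already extensional, so restricting
    to the index set is the identity.\<close>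
  have "distr (gauss_space n) (\<Pi>\<^sub>M i\<in>{..<n}. borel) (\<lambda>g. \<lambda>i\<in>{..<n}. g i)
      = distr (gauss_space n) (gauss_space n) (\<lambda>g. g)"
    using sets by (intro distr_cong) (auto simp: gauss_space_def space_PiM)
  also have "\<dots> = (\<Pi>\<^sub>M i\<in>{..<n}. distr (gauss_space n) borel (\<lambda>g. g i))"
  proof -
    have "(\<Pi>\<^sub>M i\<in>{..<n}. distr (gauss_space n) borel (\<lambda>g. g i)) = gauss_space n"
      by (subst (2) gauss_space_def) (intro PiM_cong, simp_all add: distr_gauss_component)
    then show ?thesis by (simp add: distr_id2)
  qed
  finally show ?thesis
    using False measurable_gauss_component
    by (subst prob_space.indep_vars_iff_distr_eq_PiM'[OF prob_space_gauss_space]) auto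
qed

lemma distributed_gauss_linear:
  assumes "\<exists>i<n. a i \<noteq> 0"
  shows "distributed (gauss_space n) lborel (\<lambda>g. \<Sum>i<n. a i * g i)
    (normal_density 0 (sqrt (\<Sum>i<n. (a i)\<^sup>2)))"
proof -
  interpret prob_space "gauss_space n" by (rule prob_space_gauss_space)
  \<comment> \<open>The sum rule for independent normals asks for positive standard deviations and a
    nonempty index set, so zero coefficients are dropped.\<close>
  let ?I = "{i. i < n \<and> a i \<noteq> 0}"
  have "distributed (gauss_space n) lborel (\<lambda>g. \<Sum>i\<in>?I. a i * g i)
      (normal_density (\<Sum>i\<in>?I. 0) (sqrt (\<Sum>i\<in>?I. \<bar>a i\<bar>\<^sup>2)))"
  proof (rule sum_indep_normal)
    have "indep_vars (\<lambda>_. borel) (\<lambda>i g. g i) ?I"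
      by (rule indep_vars_subset[OF indep_vars_gauss_components[of n]]) auto
    then show "indep_vars (\<lambda>_. borel) (\<lambda>i g. a i * g i) ?I"
      by (rule indep_vars_compose2) simp
    fix i assume i: "i \<in> ?I"
    then show "distributed (gauss_space n) lborel (\<lambda>g. a i * g i) (normal_density 0 \<bar>a i\<bar>)"
      using normal_density_affine[OF distributed_gauss_component[of i n], of "a i" 0] by simp
  qed (use assms in auto)
  moreover have "(\<lambda>g. \<Sum>i\<in>?I. a i * g i) = (\<lambda>g. \<Sum>i<n. a i * g i)"
    by (intro ext sum.mono_neutral_left) auto
  moreover have "(\<Sum>i\<in>?I. \<bar>a i\<bar>\<^sup>2) = (\<Sum>i<n. (a i)\<^sup>2)"
    by (simp, intro sum.mono_neutral_left) auto
  ultimately show ?thesis by simp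
qed

section \<open>Moments of Gaussian linear forms\<close>

lemma has_bochner_integral_distributed:
  fixes X :: "'a \<Rightarrow> real"
  assumes "distributed M lborel X (\<lambda>x. ennreal (f x))" "\<And>x. 0 \<le> f x"
    and "h \<in> borel_measurable borel" "has_bochner_integral lborel (\<lambda>x. f x * h x) c"
  shows "has_bochner_integral M (\<lambda>x. h (X x)) c"
  using distributed_integrable[OF assms(1), of h] distributed_integral[OF assms(1), of h] assms
  by (simp add: has_bochner_integral_iff)

text \<open>First absolute moment of a centred normal variable whose standard deviation is the
  length of \<open>a\<close>. The zero form has no density and is treated apart.\<close>

lemma gauss_linear_abs:
  "has_bochner_integral (gauss_space n) (\<lambda>g. \<bar>\<Sum>i<n. a i * g i\<bar>) (sqrt (2 / pi) * sqrt (\<Sum>i<n. (a i)\<^sup>2))"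
proof (cases "\<exists>i<n. a i \<noteq> 0")
  case True
  have pos: "0 < sqrt (\<Sum>i<n. (a i)\<^sup>2)"
    using True by (auto intro!: sum_pos2)
  show ?thesis
    using normal_moment_abs_odd[OF pos, of 0 0]
    by (intro has_bochner_integral_distributed[OF distributed_gauss_linear[OF True]])
       (simp_all add: normal_density_nonneg mult_ac)
next
  case False
  then show ?thesis by (simp add: has_bochner_integral_zero)
qed

lemma gauss_linear_square:
  "has_bochner_integral (gauss_space n) (\<lambda>g. (\<Sum>i<n. a i * g i)\<^sup>2) (\<Sum>i<n. (a i)\<^sup>2)"
proof (cases "\<exists>i<n. a i \<noteq> 0")
  case True
  have pos: "0 < sqrt (\<Sum>i<n. (a i)\<^sup>2)"
    using True by (auto intro!: sum_pos2)
  have "fact (2 * 1) / ((2 / (sqrt (\<Sum>i<n. (a i)\<^sup>2))\<^sup>2)^1 * fact 1) = (\<Sum>i<n. (a i)\<^sup>2)"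
    using pos by simp
  then show ?thesis
    using normal_moment_even[OF pos, of 0 1]
    by (intro has_bochner_integral_distributed[OF distributed_gauss_linear[OF True]])
       (simp_all add: normal_density_nonneg)
next
  case False
  then show ?thesis by (simp add: has_bochner_integral_zero)
qed

text \<open>Polarisation of \<open>gauss_linear_square\<close>. Applied to Gram vectors of
  \<open>X\<close>, it says that the associated Gaussian vector has covariance
  \<open>X\<close>.\<close>

lemma gauss_linear_product:
  "has_bochner_integral (gauss_space n) (\<lambda>g. (\<Sum>i<n. a i * g i) * (\<Sum>i<n. b i * g i)) (\<Sum>i<n. a i * b i)"
proof -
  have "has_bochner_integral (gauss_space n)
      (\<lambda>g. ((\<Sum>i<n. (a i + b i) * g i)\<^sup>2 - (\<Sum>i<n. (a i - b i) * g i)\<^sup>2) / 4)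
      (((\<Sum>i<n. (a i + b i)\<^sup>2) - (\<Sum>i<n. (a i - b i)\<^sup>2)) / 4)"
    by (intro has_bochner_integral_divide_zero has_bochner_integral_diff gauss_linear_square)
  moreover have "((\<Sum>i<n. (a i + b i) * g i)\<^sup>2 - (\<Sum>i<n. (a i - b i) * g i)\<^sup>2) / 4
      = (\<Sum>i<n. a i * g i) * (\<Sum>i<n. b i * g i)" for g
    by (simp add: distrib_right left_diff_distrib sum.distrib sum_subtractf power2_eq_square algebra_simps)
  moreover have "((\<Sum>i<n. (a i + b i)\<^sup>2) - (\<Sum>i<n. (a i - b i)\<^sup>2)) / 4 = (\<Sum>i<n. a i * b i)"
    by (simp add: sum_subtractf[symmetric] sum_divide_distrib power2_eq_square algebra_simps)
  ultimately show ?thesis by simp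
qed

section \<open>Rounding\<close>

text \<open>Nesterov's 2/pi bound, weighted by the lengths of the Gram vectors. Signs are taken from
  \<open>M y\<close> rather than from the Gaussian \<open>y\<close> itself; first absolute moments
  and covariances then take the place of arcsine identities.\<close>

lemma exists_sign_rounding:
  assumes M: "psd_form n M" and X: "psd_form n X"
  shows "\<exists>s. (\<forall>i<n. s i \<in> {-1, 1}) \<and> 2 / pi * (\<Sum>i<n. \<Sum>j<n. M i j * X i j)
    \<le> bform n M (\<lambda>i. sqrt (X i i) * s i) (\<lambda>i. sqrt (X i i) * s i)"
proof -
  obtain L where L: "\<And>i j. i < n \<Longrightarrow> j < n \<Longrightarrow> X i j = (\<Sum>l<n. L i l * L j l)"
    using psd_form_gram[OF X] by blast
  interpret prob_space "gauss_space n" by (rule prob_space_gauss_space)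
  define T where "T = (\<Sum>i<n. \<Sum>j<n. M i j * X i j)"
  \<comment> \<open>With \<open>m = sqrt (2 / pi)\<close> the argument yields the factor
    \<open>2 * c * m - c\<^sup>2\<close> in front of \<open>T\<close>, which is largest at
    \<open>c = m\<close>.\<close>
  define c where "c = sqrt (2 / pi)"
  define d where "d = (\<lambda>i. sqrt (X i i))"
  define y where "y = (\<lambda>g i. \<Sum>l<n. L i l * g l)"
  define A where "A = (\<lambda>i l. \<Sum>j<n. M i j * L j l)"
  define val where "val = (\<lambda>s. bform n M (\<lambda>i. d i * s i) (\<lambda>i. d i * s i))"
  \<comment> \<open>The tangent bound with the signs of \<open>M y\<close> inserted, where
    \<open>(M y)_i\<close> is the linear form in \<open>g\<close> with coefficients
    \<open>A i\<close>. It stays below a maximum over finitely many sign vectors for every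
    \<open>g\<close>, so integration yields a fixed sign vector.\<close>
  define F where "F = (\<lambda>g. (\<Sum>i<n. 2 * c * d i * \<bar>\<Sum>l<n. A i l * g l\<bar>)
    - c\<^sup>2 * (\<Sum>i<n. \<Sum>j<n. M i j * (y g i * y g j)))"
  let ?signs = "{..<n} \<rightarrow>\<^sub>E {-1, 1 :: real}"
  have fin: "finite (val ` ?signs)" by (intro finite_imageI finite_PiE) auto
  have c: "0 \<le> c" "c\<^sup>2 = 2 / pi" by (simp_all add: c_def)
  have F_le: "F g \<le> Max (val ` ?signs)" for g
  proof -
    define s where "s = (\<lambda>i\<in>{..<n}. if 0 \<le> (\<Sum>l<n. A i l * g l) then 1 else -1 :: real)"
    have s: "s \<in> ?signs" by (auto simp: s_def)
    have My: "(\<Sum>j<n. M i j * y g j) = (\<Sum>l<n. A i l * g l)" for i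
    proof -
      have "(\<Sum>j<n. M i j * y g j) = (\<Sum>j<n. \<Sum>l<n. M i j * L j l * g l)"
        by (simp add: y_def sum_distrib_left mult_ac)
      also have "\<dots> = (\<Sum>l<n. \<Sum>j<n. M i j * L j l * g l)" by (rule sum.swap)
      finally show ?thesis by (simp add: A_def sum_distrib_right)
    qed
    have "bform n M (\<lambda>i. d i * s i) (y g) = (\<Sum>i<n. d i * (s i * (\<Sum>j<n. M i j * y g j)))"
      by (simp add: bform_def sum_distrib_left mult_ac)
    also have "\<dots> = (\<Sum>i<n. d i * \<bar>\<Sum>l<n. A i l * g l\<bar>)"
      unfolding My by (intro sum.cong) (auto simp: s_def)
    finally have "F g = 2 * c * bform n M (\<lambda>i. d i * s i) (y g) - c\<^sup>2 * bform n M (y g) (y g)"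
      by (simp add: F_def bform_def sum_distrib_left mult_ac)
    also have "\<dots> \<le> val s" unfolding val_def by (rule bform_linear_lower_bound[OF M])
    also have "\<dots> \<le> Max (val ` ?signs)" using fin s by simp
    finally show ?thesis .
  qed
  \<comment> \<open>Written as a sum of inner products of \<open>L i\<close> and \<open>A i\<close>,
    \<open>T\<close> is accessible to Cauchy-Schwarz row by row; the length of \<open>L i\<close> is
    \<open>d i\<close>.\<close>
  have T_eq: "(\<Sum>i<n. \<Sum>l<n. L i l * A i l) = T"
  proof -
    have "(\<Sum>l<n. L i l * A i l) = (\<Sum>j<n. M i j * X i j)" if "i < n" for i
    proof -
      have "(\<Sum>l<n. L i l * A i l) = (\<Sum>l<n. \<Sum>j<n. M i j * (L i l * L j l))"
        by (simp add: A_def sum_distrib_left mult_ac)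
      also have "\<dots> = (\<Sum>j<n. \<Sum>l<n. M i j * (L i l * L j l))" by (rule sum.swap)
      finally show ?thesis using that by (simp add: L sum_distrib_left)
    qed
    then show ?thesis by (simp add: T_def)
  qed
  have "has_bochner_integral (gauss_space n) F
    ((\<Sum>i<n. 2 * c * d i * (sqrt (2 / pi) * sqrt (\<Sum>l<n. (A i l)\<^sup>2)))
      - c\<^sup>2 * (\<Sum>i<n. \<Sum>j<n. M i j * (\<Sum>l<n. L i l * L j l)))"
    unfolding F_def y_def
    by (intro has_bochner_integral_diff has_bochner_integral_sum has_bochner_integral_mult_right
        gauss_linear_abs gauss_linear_product)
  then have le_Max: "(\<Sum>i<n. 2 * c * d i * (sqrt (2 / pi) * sqrt (\<Sum>l<n. (A i l)\<^sup>2)))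
      - c\<^sup>2 * (\<Sum>i<n. \<Sum>j<n. M i j * (\<Sum>l<n. L i l * L j l)) \<le> Max (val ` ?signs)"
    using F_le integral_le_const[of F "Max (val ` ?signs)"]
    by (auto simp: has_bochner_integral_iff)
  have gram: "(\<Sum>i<n. \<Sum>j<n. M i j * (\<Sum>l<n. L i l * L j l)) = T"
    by (simp add: T_def L)
  have "2 * c\<^sup>2 * T \<le> (\<Sum>i<n. 2 * c * d i * (sqrt (2 / pi) * sqrt (\<Sum>l<n. (A i l)\<^sup>2)))"
  proof -
    have "(\<Sum>l<n. L i l * A i l) \<le> d i * sqrt (\<Sum>l<n. (A i l)\<^sup>2)" if "i < n" for i
    proof -
      have "(\<Sum>l<n. L i l * A i l) \<le> (\<Sum>l<n. \<bar>L i l\<bar> * \<bar>A i l\<bar>)"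
        by (intro sum_mono) (metis abs_ge_self abs_mult)
      also have "\<dots> \<le> L2_set (L i) {..<n} * L2_set (A i) {..<n}"
        by (rule L2_set_mult_ineq)
      finally show ?thesis
        using that by (simp add: L2_set_def d_def L power2_eq_square)
    qed
    then have "T \<le> (\<Sum>i<n. d i * sqrt (\<Sum>l<n. (A i l)\<^sup>2))"
      unfolding T_eq[symmetric] by (intro sum_mono) auto
    then have "2 * c\<^sup>2 * T \<le> 2 * c\<^sup>2 * (\<Sum>i<n. d i * sqrt (\<Sum>l<n. (A i l)\<^sup>2))"
      by (intro mult_left_mono) auto
    then show ?thesis
      unfolding c_def[symmetric] by (simp add: sum_distrib_left power2_eq_square mult_ac)
  qed
  then have "c\<^sup>2 * T \<le> Max (val ` ?signs)" using le_Max[unfolded gram] by linarith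
  then have "2 / pi * T \<le> Max (val ` ?signs)" unfolding c(2) .
  moreover have "Max (val ` ?signs) \<in> val ` ?signs"
    using fin by (intro Max_in) (auto simp: PiE_eq_empty_iff)
  ultimately obtain s where "s \<in> ?signs" "2 / pi * T \<le> val s" by auto
  then show ?thesis unfolding T_def val_def d_def by (intro exI[of _ s]) (auto simp: PiE_iff)
qed

text \<open>Averaging over two fractional vectors with opposite signs removes the mixed term between
  \<open>d\<close> and \<open>d s\<close>. The form at \<open>d\<close> later becomes the
  \<open>G\<close> term, and the form at \<open>d s\<close> dominates the trace term.\<close>

lemma psd_form_rounding:
  fixes k :: nat and X :: "nat \<Rightarrow> nat \<Rightarrow> real" and \<delta> :: real
  assumes M: "psd_form n M" and X: "psd_form n X"
    and diag: "\<And>i. i < n \<Longrightarrow> X i i \<le> 1" and trace: "(\<Sum>i<n. X i i) = k"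
    and k: "k \<le> n" and \<delta>: "0 \<le> \<delta>" "\<delta> \<le> 1"
    and D: "\<And>S. S \<subseteq> {..<n} \<Longrightarrow> card S \<le> k \<Longrightarrow>
      bform n M (\<lambda>i. of_bool (i \<in> S)) (\<lambda>i. of_bool (i \<in> S)) \<le> D"
    and W: "\<And>S. S \<subseteq> {..<n} \<Longrightarrow> k < card S \<Longrightarrow>
      bform n M (\<lambda>i. of_bool (i \<in> S)) (\<lambda>i. of_bool (i \<in> S)) \<le> W"
    and "0 \<le> W"
  shows "(1 - \<delta>)\<^sup>2 * (k / n) * ((bform n M (\<lambda>i. sqrt (X i i)) (\<lambda>i. sqrt (X i i))
      + 2 / pi * (\<Sum>i<n. \<Sum>j<n. M i j * X i j)) / 4) \<le> D + exp (- \<delta>\<^sup>2 * k / 4) * W"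
proof -
  define d where "d = (\<lambda>i. sqrt (X i i))"
  \<comment> \<open>Cauchy-Schwarz bounds the sum of \<open>d\<close> by
    \<open>sqrt (k * n)\<close>, so scaling by \<open>sqrt (k / n)\<close> meets the budget
    \<open>k\<close>; the factor \<open>1 - \<delta>\<close> reserves room for the tail
    bound.\<close>
  define \<alpha> where "\<alpha> = (1 - \<delta>) * sqrt (k / n)"
  obtain s where s: "\<And>i. i < n \<Longrightarrow> s i \<in> {-1, 1}" and
    T: "2 / pi * (\<Sum>i<n. \<Sum>j<n. M i j * X i j) \<le> bform n M (\<lambda>i. d i * s i) (\<lambda>i. d i * s i)"
    using exists_sign_rounding[OF M X] unfolding d_def by blast
  \<comment> \<open>For \<open>c\<close> in {-1, 1} the entry is \<open>\<alpha> * d i\<close> where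
    \<open>s i = c\<close>, and 0 elsewhere.\<close>
  define p where "p = (\<lambda>c i. \<alpha> / 2 * (d i + c * (d i * s i)))"
  have d: "0 \<le> d i \<and> d i \<le> 1" if "i < n" for i
    using that diag psd_form_diag_nonneg[OF X that] by (simp add: d_def)
  have "sqrt (k / n) \<le> 1" using k by (cases "n = 0") (simp_all add: divide_le_eq_1)
  then have \<alpha>: "0 \<le> \<alpha>" "\<alpha> \<le> 1" using \<delta> by (auto simp: \<alpha>_def intro!: mult_le_one)
  have p01: "0 \<le> p c i \<and> p c i \<le> \<alpha> * d i" if "i < n" "c \<in> {-1, 1}" for c i
    using d[OF that(1)] s[OF that(1)] that \<alpha> by (auto simp: p_def field_simps)
  have "\<alpha> * (\<Sum>i<n. d i) \<le> (1 - \<delta>) * k"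
  proof -
    have "(\<Sum>i<n. d i)\<^sup>2 \<le> (\<Sum>i<n. (d i)\<^sup>2) * card {..<n}"
      by (rule sum_squared_le_sum_of_squares)
    also have "(\<Sum>i<n. (d i)\<^sup>2) = k"
      using psd_form_diag_nonneg[OF X] by (simp add: d_def trace)
    finally have "(\<Sum>i<n. d i) \<le> sqrt (k * n)" by (simp add: real_le_rsqrt)
    then have "\<alpha> * (\<Sum>i<n. d i) \<le> \<alpha> * sqrt (k * n)" using \<alpha> by (intro mult_left_mono)
    also have "\<dots> \<le> (1 - \<delta>) * k"
    proof (cases "n = 0")
      case False
      have "sqrt (k / n) * sqrt (k * n) = sqrt (k / n * (k * n))"
        by (simp only: real_sqrt_mult)
      also have "k / n * (k * n) = (real k)\<^sup>2"
        using False by (simp add: power2_eq_square)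
      finally have "sqrt (k / n) * sqrt (k * n) = k" by simp
      then show ?thesis by (simp add: \<alpha>_def mult.assoc)
    qed (use \<delta> in simp)
    finally show ?thesis .
  qed
  moreover have "(\<Sum>i<n. p c i) \<le> \<alpha> * (\<Sum>i<n. d i)" if "c \<in> {-1, 1}" for c
    unfolding sum_distrib_left using p01 that by (intro sum_mono) auto
  ultimately have sum_p: "(\<Sum>i<n. p c i) \<le> (1 - \<delta>) * k" if "c \<in> {-1, 1}" for c
    using that by force
  have p1: "0 \<le> p c i \<and> p c i \<le> 1" if "i < n" "c \<in> {-1, 1}" for c i
    using p01[OF that] mult_le_one[OF \<alpha>(2), of "d i"] d[OF that(1)] by linarith
  have bound: "bform n M (p c) (p c) \<le> D + exp (- \<delta>\<^sup>2 * k / 4) * W" if "c \<in> {-1, 1}" for c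
    using that by (intro bform_rounding[OF M p1 sum_p \<delta> D W \<open>0 \<le> W\<close>])
  have "bform n M (p 1) (p 1) + bform n M (p (- 1)) (p (- 1))
      = \<alpha>\<^sup>2 / 2 * (bform n M d d + bform n M (\<lambda>i. d i * s i) (\<lambda>i. d i * s i))"
    unfolding p_def bform_scale_left bform_scale_right bform_add_self[OF M]
    by (simp add: power2_eq_square algebra_simps)
  then have "\<alpha>\<^sup>2 / 4 * (bform n M d d + bform n M (\<lambda>i. d i * s i) (\<lambda>i. d i * s i))
      \<le> D + exp (- \<delta>\<^sup>2 * k / 4) * W"
    using bound[of 1] bound[of "- 1"] by simp
  moreover have "\<alpha>\<^sup>2 = (1 - \<delta>)\<^sup>2 * (k / n)" by (simp add: \<alpha>_def power_mult_distrib)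
  moreover have "\<alpha>\<^sup>2 / 4 * (bform n M d d + 2 / pi * (\<Sum>i<n. \<Sum>j<n. M i j * X i j))
      \<le> \<alpha>\<^sup>2 / 4 * (bform n M d d + bform n M (\<lambda>i. d i * s i) (\<lambda>i. d i * s i))"
    using T by (intro mult_left_mono) auto
  ultimately show ?thesis by (simp add: d_def)
qed

section \<open>The semidefinite program\<close>

lemma scalar_prod_mult_mat_vec:
  assumes "A \<in> carrier_mat n n" "u \<in> carrier_vec n" "v \<in> carrier_vec n"
  shows "u \<bullet> (A *\<^sub>v v) = bform n (\<lambda>i j. A $$ (i, j)) (\<lambda>i. u $ i) (\<lambda>i. v $ i)"
  using assms
  by (simp add: scalar_prod_def bform_def sum_distrib_left atLeast0LessThan mult_ac)

lemma psd_mat_iff_psd_form: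
  assumes "A \<in> carrier_mat n n"
  shows "psd_mat n A \<longleftrightarrow> psd_form n (\<lambda>i j. A $$ (i, j))"
proof -
  have "transpose_mat A = A \<longleftrightarrow> (\<forall>i<n. \<forall>j<n. A $$ (i, j) = A $$ (j, i))"
    using assms by (auto simp: mat_eq_iff)
  moreover have "(\<forall>v\<in>carrier_vec n. v \<bullet> (A *\<^sub>v v) \<ge> 0) \<longleftrightarrow>
      (\<forall>v. 0 \<le> bform n (\<lambda>i j. A $$ (i, j)) v v)" (is "?l \<longleftrightarrow> ?r")
  proof
    assume ?l
    then have "0 \<le> vec n v \<bullet> (A *\<^sub>v vec n v)" for v by simp
    moreover have "vec n v \<bullet> (A *\<^sub>v vec n v) = bform n (\<lambda>i j. A $$ (i, j)) v v" for v
      unfolding scalar_prod_mult_mat_vec[OF assms vec_carrier vec_carrier]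
      by (rule bform_cong) auto
    ultimately show ?r by simp
  qed (use assms in \<open>auto simp: scalar_prod_mult_mat_vec\<close>)
  ultimately show ?thesis using assms by (auto simp: psd_mat_def psd_form_def)
qed

lemma trace_mat_mult:
  assumes "A \<in> carrier_mat n n" "B \<in> carrier_mat n n"
  shows "trace_mat (A * B) = (\<Sum>i<n. \<Sum>j<n. A $$ (i, j) * B $$ (j, i))"
  using assms by (simp add: trace_mat_def scalar_prod_def atLeast0LessThan)

lemma trace_mat_sqrt_diag:
  assumes "psd_mat n M" "psd_mat n X"
  shows "trace_mat (M * sqrt_diag_mat n X)
    = bform n (\<lambda>i j. M $$ (i, j)) (\<lambda>i. sqrt (X $$ (i, i))) (\<lambda>i. sqrt (X $$ (i, i)))"
proof -
  have "M \<in> carrier_mat n n" using assms by (simp add: psd_mat_def)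
  then have "trace_mat (M * sqrt_diag_mat n X) = (\<Sum>i<n. \<Sum>j<n. M $$ (i, j) * sqrt_diag_mat n X $$ (j, i))"
    by (rule trace_mat_mult) (simp add: sqrt_diag_mat_def)
  then show ?thesis by (simp add: bform_def sqrt_diag_mat_def real_sqrt_mult mult_ac)
qed

lemma sdp_optimal_value:
  assumes "sdp_optimal n k M X"
  shows "sdp_value n k M = trace_mat (M * X)"
  unfolding sdp_value_def
  using assms by (intro cSup_eq_maximum) (auto simp: sdp_optimal_def)

text \<open>The tool for comparing concrete matrices with the program. A given optimal solution
  makes the supremum a maximum, so feasibility of \<open>Y\<close> is all there is to check.\<close>

lemma sdp_optimal_upper_bound:
  assumes M: "psd_mat n M" and X: "sdp_optimal n k M X" and Y: "psd_form n Y"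
    and "\<And>i j. i < n \<Longrightarrow> j < n \<Longrightarrow> 0 \<le> Y i j \<and> Y i j \<le> 1" "(\<Sum>i<n. Y i i) = real k"
  shows "(\<Sum>i<n. \<Sum>j<n. M $$ (i, j) * Y i j) \<le> sdp_value n k M"
proof -
  have carrier: "mat n n (\<lambda>(i, j). Y i j) \<in> carrier_mat n n" by simp
  have "psd_form n (\<lambda>i j. mat n n (\<lambda>(i, j). Y i j) $$ (i, j))"
  proof -
    have "bform n (\<lambda>i j. mat n n (\<lambda>(i, j). Y i j) $$ (i, j)) v v = bform n Y v v" for v
      by (rule bform_cong) auto
    then show ?thesis using Y by (simp add: psd_form_def)
  qed
  then have "mat n n (\<lambda>(i, j). Y i j) \<in> sdp_feasible n k"
    using assms(4,5) psd_mat_iff_psd_form[OF carrier] by (simp add: sdp_feasible_def trace_mat_def)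
  then have "trace_mat (M * mat n n (\<lambda>(i, j). Y i j)) \<le> sdp_value n k M"
    using X by (simp add: sdp_optimal_value[OF X] sdp_optimal_def)
  moreover have "trace_mat (M * mat n n (\<lambda>(i, j). Y i j)) = (\<Sum>i<n. \<Sum>j<n. M $$ (i, j) * Y i j)"
  proof -
    have "M \<in> carrier_mat n n" using M by (simp add: psd_mat_def)
    then show ?thesis
      using psd_form_sym[OF Y] by (auto simp: trace_mat_mult[OF _ carrier] intro!: sum.cong)
  qed
  ultimately show ?thesis by simp
qed

section \<open>Feasible matrices built from index sets\<close>

lemma bform_rank_one: "bform n (\<lambda>i j. u i * u j) v v = (\<Sum>i<n. u i * v i)\<^sup>2"
  by (simp add: bform_def power2_eq_square sum_product mult_ac)

lemma bform_diagonal: "bform n (\<lambda>i j. if i = j then c i else 0) v v = (\<Sum>i<n. c i * (v i)\<^sup>2)"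
proof -
  have "(\<Sum>j<n. (if i = j then c i else 0) * v i * v j) = (\<Sum>j<n. if i = j then c i * (v i)\<^sup>2 else 0)" for i
    by (intro sum.cong) (auto simp: power2_eq_square)
  then show ?thesis by (simp add: bform_def)
qed

lemma bform_add_matrix: "bform n (\<lambda>i j. A i j + B i j) u v = bform n A u v + bform n B u v"
  and bform_scale_matrix: "bform n (\<lambda>i j. c * A i j) u v = c * bform n A u v"
  by (simp_all add: bform_def algebra_simps sum.distrib sum_distrib_left)

text \<open>
  A set with fewer than \<open>k\<close> elements is completed to trace \<open>k\<close> by diagonal ones
  outside of it; this does not decrease the objective, as \<open>M\<close> has a nonnegative diagonal.
\<close>

lemma small_subset_le_sdp_value:
  assumes M: "psd_mat n M" and X: "sdp_optimal n k M X" and "k \<le> n"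
    and S: "S \<subseteq> {..<n}" "card S \<le> k"
  shows "bform n (\<lambda>i j. M $$ (i, j)) (\<lambda>i. of_bool (i \<in> S)) (\<lambda>i. of_bool (i \<in> S)) \<le> sdp_value n k M"
proof -
  let ?e = "\<lambda>i. of_bool (i \<in> S) :: real"
  have fS: "finite S" using S(1) finite_subset by blast
  have "k - card S \<le> card ({..<n} - S)"
    using S \<open>k \<le> n\<close> by (simp add: card_Diff_subset fS)
  then obtain R where R: "R \<subseteq> {..<n} - S" "card R = k - card S"
    by (metis obtain_subset_with_card_n)
  define Y where "Y = (\<lambda>i j. ?e i * ?e j + (if i = j then of_bool (i \<in> R) else 0))"
  have M_psd: "psd_form n (\<lambda>i j. M $$ (i, j))"
    using M psd_mat_iff_psd_form by (auto simp: psd_mat_def)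
  have "psd_form n Y"
    unfolding psd_form_def Y_def bform_add_matrix bform_rank_one bform_diagonal
    by (auto intro!: add_nonneg_nonneg sum_nonneg)
  moreover have "0 \<le> Y i j \<and> Y i j \<le> 1" for i j
    using R(1) by (auto simp: Y_def of_bool_def)
  moreover have "(\<Sum>i<n. Y i i) = real k"
  proof -
    have "(\<Sum>i<n. Y i i) = (\<Sum>i<n. ?e i) + (\<Sum>i<n. of_bool (i \<in> R))"
      by (simp add: Y_def sum.distrib)
    also have "{..<n} \<inter> S = S" "{..<n} \<inter> R = R" using S R by auto
    then have "(\<Sum>i<n. ?e i) + (\<Sum>i<n. of_bool (i \<in> R)) = real (card S) + real (card R)"
      by simp
    finally show ?thesis using R S by simp
  qed
  ultimately have "(\<Sum>i<n. \<Sum>j<n. M $$ (i, j) * Y i j) \<le> sdp_value n k M"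
    by (intro sdp_optimal_upper_bound[OF M X])
  moreover have "(\<Sum>i<n. \<Sum>j<n. M $$ (i, j) * Y i j)
      = bform n (\<lambda>i j. M $$ (i, j)) ?e ?e + (\<Sum>i<n. \<Sum>j<n. if i = j then M $$ (i, i) * of_bool (i \<in> R) else 0)"
    unfolding bform_def sum.distrib[symmetric] Y_def
    by (intro sum.cong) (auto simp: algebra_simps)
  moreover have "0 \<le> (\<Sum>i<n. \<Sum>j<n. if i = j then M $$ (i, i) * of_bool (i \<in> R) else 0)"
    using psd_form_diag_nonneg[OF M_psd] by (auto intro!: sum_nonneg)
  ultimately show ?thesis by linarith
qed

text \<open>The factor \<open>k / card S\<close> brings the rank-one matrix of \<open>S\<close> down
  to trace \<open>k\<close> and, being below 1, keeps the entries in range. This bounds the value of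
  sets that overshoot in the rounding.\<close>

lemma large_subset_le_sdp_value:
  assumes M: "psd_mat n M" and X: "sdp_optimal n k M X" and "0 < k"
    and S: "S \<subseteq> {..<n}" "k < card S"
  shows "k / card S * bform n (\<lambda>i j. M $$ (i, j)) (\<lambda>i. of_bool (i \<in> S)) (\<lambda>i. of_bool (i \<in> S))
    \<le> sdp_value n k M"
proof -
  let ?e = "\<lambda>i. of_bool (i \<in> S) :: real"
  define Y where "Y = (\<lambda>i j. k / card S * (?e i * ?e j))"
  have "psd_form n Y"
    unfolding psd_form_def Y_def bform_scale_matrix bform_rank_one by auto
  moreover have "0 \<le> Y i j \<and> Y i j \<le> 1" for i j
    using S by (auto simp: Y_def of_bool_def)
  moreover have "(\<Sum>i<n. Y i i) = real k"
  proof -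
    have "(\<Sum>i<n. Y i i) = k / card S * (\<Sum>i<n. ?e i)"
      unfolding sum_distrib_left Y_def by (intro sum.cong) auto
    also have "{..<n} \<inter> S = S" using S by auto
    then have "(\<Sum>i<n. ?e i) = card S" by simp
    finally show ?thesis using S by simp
  qed
  ultimately have "(\<Sum>i<n. \<Sum>j<n. M $$ (i, j) * Y i j) \<le> sdp_value n k M"
    by (intro sdp_optimal_upper_bound[OF M X])
  moreover have "(\<Sum>i<n. \<Sum>j<n. M $$ (i, j) * Y i j) = k / card S * bform n (\<lambda>i j. M $$ (i, j)) ?e ?e"
    unfolding bform_def sum_distrib_left Y_def by (intro sum.cong) (auto simp: mult_ac)
  ultimately show ?thesis by simp
qed

section \<open>The combinatorial optimum in terms of index sets\<close>

lemma zero_one_quadratic_values: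
  assumes "M \<in> carrier_mat n n"
  shows "(\<lambda>u. u \<bullet> (M *\<^sub>v u)) ` zero_one_vecs n k
    = (\<lambda>S. bform n (\<lambda>i j. M $$ (i, j)) (\<lambda>i. of_bool (i \<in> S)) (\<lambda>i. of_bool (i \<in> S)))
      ` {S. S \<subseteq> {..<n} \<and> card S \<le> k}"
proof -
  have *: "ones_vec n \<bullet> u = (\<Sum>i<n. u $ i)" if "u \<in> carrier_vec n" for u
    using that by (simp add: ones_vec_def scalar_prod_def atLeast0LessThan)
  have "zero_one_vecs n k = (\<lambda>S. vec n (\<lambda>i. of_bool (i \<in> S))) ` {S. S \<subseteq> {..<n} \<and> card S \<le> k}"
    (is "_ = ?I")
  proof (intro equalityI subsetI)
    fix u assume u: "u \<in> zero_one_vecs n k"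
    let ?S = "{i. i < n \<and> u $ i = 1}"
    have ueq: "u = vec n (\<lambda>i. of_bool (i \<in> ?S))"
      using u by (auto simp: zero_one_vecs_def vec_eq_iff)
    have "real (card ?S) = (\<Sum>i<n. of_bool (i \<in> ?S))"
      by (simp add: Int_def)
    also have "\<dots> = (\<Sum>i<n. u $ i)" using u by (intro sum.cong) (auto simp: zero_one_vecs_def)
    also have "\<dots> \<le> k" using u * by (auto simp: zero_one_vecs_def)
    finally show "u \<in> ?I" using ueq by (intro image_eqI[of _ _ ?S]) auto
  next
    fix u assume "u \<in> ?I"
    then obtain S where S: "S \<subseteq> {..<n}" "card S \<le> k" and u: "u = vec n (\<lambda>i. of_bool (i \<in> S))" by auto
    have "{..<n} \<inter> S = S" using S by auto
    then have "(\<Sum>i<n. u $ i) = card S" by (simp add: u)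
    then show "u \<in> zero_one_vecs n k"
      using S *[of u] by (auto simp: zero_one_vecs_def u)
  qed
  moreover have "vec n (\<lambda>i. of_bool (i \<in> S)) \<bullet> (M *\<^sub>v vec n (\<lambda>i. of_bool (i \<in> S)))
      = bform n (\<lambda>i j. M $$ (i, j)) (\<lambda>i. of_bool (i \<in> S)) (\<lambda>i. of_bool (i \<in> S))" for S
    unfolding scalar_prod_mult_mat_vec[OF assms vec_carrier vec_carrier]
    by (rule bform_cong) auto
  ultimately show ?thesis by (simp add: image_image)
qed

lemma finite_small_subsets: "finite {S. S \<subseteq> {..<n::nat} \<and> card S \<le> k}"
  by (rule finite_subset[of _ "Pow {..<n}"]) auto

lemma D_max_ge:
  assumes "M \<in> carrier_mat n n" "S \<subseteq> {..<n}" "card S \<le> k"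
  shows "bform n (\<lambda>i j. M $$ (i, j)) (\<lambda>i. of_bool (i \<in> S)) (\<lambda>i. of_bool (i \<in> S)) \<le> D_max n k M"
  unfolding D_max_def zero_one_quadratic_values[OF assms(1)]
  using assms finite_small_subsets by (intro Max_ge) auto

lemma D_max_le_sdp_value:
  assumes "psd_mat n M" "sdp_optimal n k M X" "k \<le> n"
  shows "D_max n k M \<le> sdp_value n k M"
proof -
  have "M \<in> carrier_mat n n" using assms by (simp add: psd_mat_def)
  then show ?thesis
    unfolding D_max_def zero_one_quadratic_values[OF \<open>M \<in> carrier_mat n n\<close>]
    using small_subset_le_sdp_value[OF assms] finite_small_subsets
    by (subst Max_le_iff) (auto intro!: exI[of _ "{}"])
qed

text \<open>Oversized sets have value at most \<open>n / k\<close> times the program value, since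
  \<open>card S \<le> n\<close>. The resulting additive error is turned into a relative one, so that
  the whole bound is a multiple of \<open>Z\<close>.\<close>

lemma sdp_rounding:
  fixes \<delta> :: real
  assumes M: "psd_mat n M" and X: "sdp_optimal n k M X" and k: "0 < k" "k \<le> n"
    and \<delta>: "0 \<le> \<delta>" "\<delta> \<le> 1"
  defines "Z \<equiv> 1/4 * trace_mat (M * sqrt_diag_mat n X) + 1 / (2 * pi) * sdp_value n k M"
  shows "0 \<le> Z" and "0 \<le> trace_mat (M * sqrt_diag_mat n X)"
    and "k / n * ((1 - \<delta>)\<^sup>2 - 2 * pi * ((real n)\<^sup>2 / (real k)\<^sup>2) * exp (- \<delta>\<^sup>2 * k / 4)) * Z \<le> D_max n k M"
proof -
  let ?M = "\<lambda>i j. M $$ (i, j)" and ?X = "\<lambda>i j. X $$ (i, j)"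
  define V where "V = sdp_value n k M"
  have X_feas: "X \<in> sdp_feasible n k" using X by (simp add: sdp_optimal_def)
  have M_car: "M \<in> carrier_mat n n" and X_car: "X \<in> carrier_mat n n"
    using M X_feas by (auto simp: psd_mat_def sdp_feasible_def)
  have M_psd: "psd_form n ?M" and X_psd: "psd_form n ?X"
    using M X_feas psd_mat_iff_psd_form[OF M_car] psd_mat_iff_psd_form[OF X_car]
    by (auto simp: sdp_feasible_def)
  have V0: "0 \<le> V"
    using small_subset_le_sdp_value[OF M X k(2), of "{}"] by (simp add: V_def bform_def)
  have G: "trace_mat (M * sqrt_diag_mat n X) = bform n ?M (\<lambda>i. sqrt (?X i i)) (\<lambda>i. sqrt (?X i i))"
    using X_feas M by (intro trace_mat_sqrt_diag) (auto simp: sdp_feasible_def)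
  show G0: "0 \<le> trace_mat (M * sqrt_diag_mat n X)"
    unfolding G by (rule psd_form_nonneg[OF M_psd])
  show Z0: "0 \<le> Z" using G0 V0 by (simp add: Z_def V_def)
  have V: "V = (\<Sum>i<n. \<Sum>j<n. ?M i j * ?X i j)"
    using psd_form_sym[OF X_psd]
    by (auto simp: V_def sdp_optimal_value[OF X] trace_mat_mult[OF M_car X_car] intro!: sum.cong)
  have large: "bform n ?M (\<lambda>i. of_bool (i \<in> S)) (\<lambda>i. of_bool (i \<in> S)) \<le> n / k * V"
    if S: "S \<subseteq> {..<n}" "k < card S" for S
  proof -
    have "card S \<le> n" using S(1) by (metis card_lessThan card_mono finite_lessThan)
    then have "card S / k * V \<le> n / k * V"
      using V0 by (intro mult_right_mono divide_right_mono) auto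
    moreover have "bform n ?M (\<lambda>i. of_bool (i \<in> S)) (\<lambda>i. of_bool (i \<in> S)) \<le> card S / k * V"
      using large_subset_le_sdp_value[OF M X k(1) S] k S by (simp add: V_def field_simps)
    ultimately show ?thesis by linarith
  qed
  define \<epsilon> where "\<epsilon> = exp (- \<delta>\<^sup>2 * k / 4)"
  have "(1 - \<delta>)\<^sup>2 * (k / n) * ((bform n ?M (\<lambda>i. sqrt (?X i i)) (\<lambda>i. sqrt (?X i i))
      + 2 / pi * (\<Sum>i<n. \<Sum>j<n. ?M i j * ?X i j)) / 4) \<le> D_max n k M + \<epsilon> * (n / k * V)"
    unfolding \<epsilon>_def using X_feas X_car V0
    by (intro psd_form_rounding[OF M_psd X_psd _ _ k(2) \<delta> D_max_ge[OF M_car] large])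
       (auto simp: sdp_feasible_def trace_mat_def)
  also have "(bform n ?M (\<lambda>i. sqrt (?X i i)) (\<lambda>i. sqrt (?X i i))
      + 2 / pi * (\<Sum>i<n. \<Sum>j<n. ?M i j * ?X i j)) / 4 = Z"
    unfolding V[symmetric] G[symmetric] by (simp add: Z_def V_def field_simps)
  finally have "(1 - \<delta>)\<^sup>2 * (k / n) * Z - \<epsilon> * (n / k * V) \<le> D_max n k M" by simp
  \<comment> \<open>Since the trace with \<open>G\<close> is nonnegative, \<open>V\<close> is at
    most \<open>2 * pi * Z\<close>. Taking \<open>k / n\<close> out of the error then produces the
    factor \<open>2 * pi * n\<^sup>2 / k\<^sup>2\<close>.\<close>
  moreover have "\<epsilon> * (n / k * V) \<le> \<epsilon> * (n / k * (2 * pi * Z))"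
  proof -
    have "V \<le> 2 * pi * Z" using G0 by (simp add: Z_def V_def field_simps)
    then show ?thesis by (intro mult_left_mono) (auto simp: \<epsilon>_def)
  qed
  moreover have "k / n * ((1 - \<delta>)\<^sup>2 - 2 * pi * ((real n)\<^sup>2 / (real k)\<^sup>2) * \<epsilon>) * Z
      = (1 - \<delta>)\<^sup>2 * (k / n) * Z - \<epsilon> * (n / k * (2 * pi * Z))"
    using k by (simp add: power2_eq_square divide_simps) (simp add: algebra_simps)
  ultimately show "k / n * ((1 - \<delta>)\<^sup>2 - 2 * pi * ((real n)\<^sup>2 / (real k)\<^sup>2) * exp (- \<delta>\<^sup>2 * k / 4)) * Z \<le> D_max n k M"
    unfolding \<epsilon>_def by linarith
qed

section \<open>Asymptotics\<close>

text \<open>The assumptions on \<open>n\<close> hold eventually; with the one on \<open>k\<close>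
  they keep \<open>1 - 2 * k powr (-1/3)\<close> nonnegative and the denominator in
  \<open>mu\<close> at least 1/2. Hence \<open>mu\<close> exceeds its first factor by at most an
  exponentially small amount, uniformly in \<open>k\<close>.\<close>

lemma mu_bounds:
  assumes n: "2 \<le> real n powr (1/9)" and k: "real n powr (1/3) \<le> real k"
    and \<eta>: "2 * pi * real n powr (4/3) * exp (- (real n powr (1/9)) / 3) \<le> 1/2"
  shows "1 - 2 * real k powr (-1/3) \<le> mu n k"
    and "mu n k \<le> 1 - 2 * real k powr (-1/3)
      + 4 * pi * real n powr (4/3) * exp (- (real n powr (1/9)) / 3)"
    and "real k powr (-1/3) \<le> real n powr (-1/9)" and "real k powr (-1/3) \<le> 1/2"
    and "(real n)\<^sup>2 / (real k)\<^sup>2 \<le> real n powr (4/3)"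
proof -
  define e where "e = exp (- (real n powr (1/9)) / 3)"
  define \<delta> where "\<delta> = real k powr (-1/3)"
  define h where "h = 2 * pi * real n powr (4/3) * e"
  define q where "q = 2 * pi * (real n)\<^sup>2 / (real k)\<^sup>2 * e"
  have n0: "0 < real n" using n by (cases "n = 0") auto
  then have k0: "0 < real k" using k by (smt (verit) powr_gt_zero)
  show ratio: "(real n)\<^sup>2 / (real k)\<^sup>2 \<le> real n powr (4/3)"
  proof -
    have "(real n powr (1/3))\<^sup>2 \<le> (real k)\<^sup>2" using k by (intro power_mono) auto
    then have "(real n)\<^sup>2 / (real k)\<^sup>2 \<le> (real n)\<^sup>2 / (real n powr (1/3))\<^sup>2"
      using n0 k0 by (intro divide_left_mono) auto
    also have "\<dots> = real n powr (4/3)"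
      using n0 by (simp add: powr_numeral[symmetric] powr_powr powr_diff[symmetric] del: powr_numeral)
    finally show ?thesis .
  qed
  have "real k powr (-1/3) \<le> (real n powr (1/3)) powr (-1/3)"
    using k n0 by (intro powr_mono2') auto
  then show \<delta>_le: "real k powr (-1/3) \<le> real n powr (-1/9)" by (simp add: powr_powr)
  also have "real n powr (-1/9) = 1 / real n powr (1/9)" by (simp add: powr_minus_divide)
  also have "\<dots> \<le> 1/2" using n by (intro frac_le) auto
  finally show half: "real k powr (-1/3) \<le> 1/2" .
  have q: "0 \<le> q" "q \<le> h"
    using mult_left_mono[OF ratio, of "2 * pi * e"] by (simp_all add: q_def h_def e_def mult_ac)
  have h: "h \<le> 1/2" using \<eta> by (simp add: h_def e_def)
  have mu: "mu n k = (1 - 2 * \<delta>) * (1 / (1 - q))"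
    by (simp add: mu_def \<delta>_def q_def e_def powr_minus_divide)
  have r: "1 \<le> 1 / (1 - q)" using q h by simp
  \<comment> \<open>On [0, 1/2] the product
    \<open>(1 + 2 * q) * (1 - q) = 1 + q * (1 - 2 * q)\<close> is at least 1.\<close>
  have "1 / (1 - q) \<le> 1 + 2 * q"
  proof -
    have "q * (1 - 2 * q) \<ge> 0" using q h by (intro mult_nonneg_nonneg) auto
    then have "1 \<le> (1 + 2 * q) * (1 - q)" by (simp add: algebra_simps)
    then show ?thesis using q h by (simp add: divide_le_eq)
  qed
  also have "\<dots> \<le> 1 + 2 * h" using q by simp
  finally have r2: "1 / (1 - q) \<le> 1 + 2 * h" .
  have \<delta>: "0 \<le> 1 - 2 * \<delta>" "1 - 2 * \<delta> \<le> 1" using half by (simp_all add: \<delta>_def)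
  show "1 - 2 * real k powr (-1/3) \<le> mu n k"
    unfolding mu \<delta>_def[symmetric] using mult_left_mono[OF r \<delta>(1)] by simp
  have "mu n k \<le> (1 - 2 * \<delta>) * (1 + 2 * h)"
    unfolding mu using mult_left_mono[OF r2 \<delta>(1)] .
  also have "\<dots> \<le> 1 - 2 * \<delta> + 2 * h"
    using q mult_right_mono[OF \<delta>(2), of "2 * h"] by (simp add: algebra_simps)
  finally show "mu n k \<le> 1 - 2 * real k powr (-1/3)
      + 4 * pi * real n powr (4/3) * exp (- (real n powr (1/9)) / 3)"
    by (simp add: h_def \<delta>_def e_def mult_ac)
qed

text \<open>
  The Chernoff bound decays only like \<open>exp (- n powr (1/9) / 4)\<close>; the loss against the
  exponent \<open>1/3\<close> in \<^const>\<open>mu\<close> is covered by the square of \<open>k powr (-1/3)\<close>.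
\<close>

lemma mu_le_rounding_factor:
  "\<exists>n0::nat. \<forall>n\<ge>n0. \<forall>k::nat. real n powr (1/3) \<le> real k \<longrightarrow> k \<le> n \<longrightarrow>
    mu n k \<le> (1 - real k powr (-1/3))\<^sup>2
      - 2 * pi * ((real n)\<^sup>2 / (real k)\<^sup>2) * exp (- (real k powr (-1/3))\<^sup>2 * real k / 4)"
proof -
  \<comment> \<open>In the last condition, \<open>n powr (-2/3)\<close> is a lower bound for the
    square of \<open>k powr (-1/3)\<close>, as \<open>k \<le> n\<close>; this polynomial slack
    absorbs both exponential errors.\<close>
  have "\<forall>\<^sub>F n :: nat in sequentially. 2 \<le> real n powr (1/9)
      \<and> 2 * pi * real n powr (4/3) * exp (- (real n powr (1/9)) / 3) \<le> 1/2
      \<and> 4 * pi * real n powr (4/3) * exp (- (real n powr (1/9)) / 3)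
        + 2 * pi * real n powr (4/3) * exp (- (real n powr (1/9)) / 4) \<le> real n powr (-2/3)"
    by (intro eventually_conj; real_asymp)
  then obtain n0 where n0: "\<And>n. n \<ge> n0 \<Longrightarrow> 2 \<le> real n powr (1/9)
      \<and> 2 * pi * real n powr (4/3) * exp (- (real n powr (1/9)) / 3) \<le> 1/2
      \<and> 4 * pi * real n powr (4/3) * exp (- (real n powr (1/9)) / 3)
        + 2 * pi * real n powr (4/3) * exp (- (real n powr (1/9)) / 4) \<le> real n powr (-2/3)"
    unfolding eventually_sequentially by blast
  show ?thesis
  proof (intro exI[of _ n0] allI impI)
    fix n k :: nat
    assume "n0 \<le> n" and k: "real n powr (1/3) \<le> real k" "k \<le> n"
    note n = n0[OF \<open>n0 \<le> n\<close>]
    note mu = mu_bounds[OF n[THEN conjunct1] k(1) n[THEN conjunct2, THEN conjunct1]]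
    define \<delta> where "\<delta> = real k powr (-1/3)"
    have "0 < real n" using n by (cases "n = 0") auto
    then have k0: "0 < real k" using k by (smt (verit) powr_gt_zero)
    have "real n powr (1/9) = (real n powr (1/3)) powr (1/3)" by (simp add: powr_powr)
    also have "\<dots> \<le> real k powr (1/3)" using k by (intro powr_mono2) auto
    also have "\<dots> = \<delta>\<^sup>2 * real k"
      using k0 by (simp add: \<delta>_def powr_numeral[symmetric] powr_powr powr_mult_base mult.commute del: powr_numeral)
    finally have "exp (- \<delta>\<^sup>2 * real k / 4) \<le> exp (- (real n powr (1/9)) / 4)" by simp
    then have "2 * pi * ((real n)\<^sup>2 / (real k)\<^sup>2) * exp (- \<delta>\<^sup>2 * real k / 4)
        \<le> 2 * pi * real n powr (4/3) * exp (- (real n powr (1/9)) / 4)"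
      using mu(5) by (intro mult_mono) auto
    moreover have "real n powr (-2/3) \<le> \<delta>\<^sup>2"
    proof -
      have "real n powr (-2/3) \<le> real k powr (-2/3)" using k k0 by (intro powr_mono2') auto
      also have "\<dots> = \<delta>\<^sup>2"
        using k0 by (simp add: \<delta>_def powr_numeral[symmetric] powr_powr del: powr_numeral)
      finally show ?thesis .
    qed
    moreover have "(1 - \<delta>)\<^sup>2 = 1 - 2 * \<delta> + \<delta>\<^sup>2" by (simp add: power2_eq_square algebra_simps)
    ultimately show "mu n k \<le> (1 - real k powr (-1/3))\<^sup>2
      - 2 * pi * ((real n)\<^sup>2 / (real k)\<^sup>2) * exp (- (real k powr (-1/3))\<^sup>2 * real k / 4)"
      using mu(2) n unfolding \<delta>_def[symmetric] by linarith
  qed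
qed

text \<open>By \<open>mu_bounds\<close> and \<open>k powr (-1/3) \<le> n powr (-1/9)\<close>, the
  distance of \<open>mu\<close> from 1 has a bound in \<open>n\<close> alone, which makes the
  convergence uniform in \<open>k\<close>.\<close>

lemma mu_tendsto_1:
  assumes "0 < \<epsilon>"
  shows "\<exists>N::nat. \<forall>n\<ge>N. \<forall>k::nat. real n powr (1/3) \<le> real k \<longrightarrow> \<bar>mu n k - 1\<bar> < \<epsilon>"
proof -
  have "(\<lambda>n::nat. 2 * real n powr (-1/9)
      + 4 * pi * real n powr (4/3) * exp (- (real n powr (1/9)) / 3)) \<longlonglongrightarrow> 0"
    by real_asymp
  then have "\<forall>\<^sub>F n :: nat in sequentially. 2 * real n powr (-1/9)
      + 4 * pi * real n powr (4/3) * exp (- (real n powr (1/9)) / 3) < \<epsilon>"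
    using assms by (rule order_tendstoD(2))
  moreover have "\<forall>\<^sub>F n :: nat in sequentially. 2 \<le> real n powr (1/9)
      \<and> 2 * pi * real n powr (4/3) * exp (- (real n powr (1/9)) / 3) \<le> 1/2"
    by (intro eventually_conj; real_asymp)
  ultimately have "\<forall>\<^sub>F n :: nat in sequentially. \<forall>k::nat. real n powr (1/3) \<le> real k \<longrightarrow> \<bar>mu n k - 1\<bar> < \<epsilon>"
  proof eventually_elim
    case (elim n)
    show ?case
    proof (intro allI impI)
      fix k :: nat
      assume k: "real n powr (1/3) \<le> real k"
      note mu = mu_bounds[OF elim(2)[THEN conjunct1] k elim(2)[THEN conjunct2]]
      have "0 \<le> real k powr (-1/3)"
        "0 \<le> 4 * pi * real n powr (4/3) * exp (- (real n powr (1/9)) / 3)" by auto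
      then show "\<bar>mu n k - 1\<bar> < \<epsilon>" using mu(1-3) elim(1) unfolding abs_less_iff by linarith
    qed
  qed
  then show ?thesis unfolding eventually_sequentially by blast
qed

theorem proposition4p1:
  shows "(\<exists>n0::nat. \<forall>n\<ge>n0. \<forall>k::nat. real n powr (1/3) \<le> real k \<and> k \<le> n \<longrightarrow>
            (\<forall>M X :: real mat. psd_mat n M \<and> sdp_optimal n k M X \<longrightarrow>
              (let G = sqrt_diag_mat n X in
                real k / real n * mu n k *
                    (1/4 * trace_mat (M * G) + 1 / (2 * pi) * sdp_value n k M) \<le> D_max n k M \<and>
                D_max n k M \<le> sdp_value n k M \<and>
                0 \<le> trace_mat (M * G)))) \<and>
         (\<forall>\<epsilon>>0. \<exists>N::nat. \<forall>n\<ge>N. \<forall>k::nat. real n powr (1/3) \<le> real k \<and> k \<le> n \<longrightarrow>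
            \<bar>mu n k - 1\<bar> < \<epsilon>)"
proof (rule conjI)
  obtain n0 :: nat where n0: "\<And>n k. n0 \<le> n \<Longrightarrow> real n powr (1/3) \<le> real k \<Longrightarrow> k \<le> n \<Longrightarrow>
    mu n k \<le> (1 - real k powr (-1/3))\<^sup>2
      - 2 * pi * ((real n)\<^sup>2 / (real k)\<^sup>2) * exp (- (real k powr (-1/3))\<^sup>2 * real k / 4)"
    using mu_le_rounding_factor by blast
  show "\<exists>n0::nat. \<forall>n\<ge>n0. \<forall>k::nat. real n powr (1/3) \<le> real k \<and> k \<le> n \<longrightarrow>
            (\<forall>M X :: real mat. psd_mat n M \<and> sdp_optimal n k M X \<longrightarrow>
              (let G = sqrt_diag_mat n X in
                real k / real n * mu n k *
                    (1/4 * trace_mat (M * G) + 1 / (2 * pi) * sdp_value n k M) \<le> D_max n k M \<and>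
                D_max n k M \<le> sdp_value n k M \<and>
                0 \<le> trace_mat (M * G)))"
    unfolding Let_def
  \<comment> \<open>With \<open>n \<ge> 1\<close>, the assumption
    \<open>n powr (1/3) \<le> k\<close> makes \<open>k\<close> positive.\<close>
  proof (intro exI[of _ "max 1 n0"] allI impI)
    fix n k :: nat and M X :: "real mat"
    assume n: "max 1 n0 \<le> n" and k: "real n powr (1/3) \<le> real k \<and> k \<le> n"
      and MX: "psd_mat n M \<and> sdp_optimal n k M X"
    let ?G = "sqrt_diag_mat n X"
    \<comment> \<open>With this choice \<open>(1 - \<delta>)\<^sup>2\<close> is the first factor
      \<open>1 - 2 * k powr (-1/3)\<close> of \<open>mu\<close> plus a square to spend on the
      errors, while the Chernoff exponent still grows like \<open>k powr (1/3)\<close>.\<close>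
    let ?\<delta> = "real k powr (-1/3)"
    let ?f = "(1 - ?\<delta>)\<^sup>2 - 2 * pi * ((real n)\<^sup>2 / (real k)\<^sup>2) * exp (- ?\<delta>\<^sup>2 * real k / 4)"
    let ?Z = "1/4 * trace_mat (M * ?G) + 1 / (2 * pi) * sdp_value n k M"
    have "0 < real n powr (1/3)" using n by simp
    then have k0: "0 < k" using k by (cases "k = 0") auto
    then have "?\<delta> \<le> 1" using powr_mono2'[of "-1/3" 1 "real k"] by simp
    note rounding = sdp_rounding[OF conjunct1[OF MX] conjunct2[OF MX] k0 conjunct2[OF k] _ this]
    \<comment> \<open>Replacing \<open>mu\<close> by the larger rounding factor is legitimate
      because \<open>?Z\<close> is nonnegative.\<close>
    have "real k / real n * mu n k * ?Z \<le> real k / real n * ?f * ?Z"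
      using n0[of n k] n k rounding(1) by (intro mult_right_mono mult_left_mono) auto
    also have "\<dots> \<le> D_max n k M" using rounding(3) by simp
    finally show "real k / real n * mu n k * ?Z \<le> D_max n k M
        \<and> D_max n k M \<le> sdp_value n k M \<and> 0 \<le> trace_mat (M * ?G)"
      using rounding(2) D_max_le_sdp_value MX k by auto
  qed
  show "\<forall>\<epsilon>>0. \<exists>N::nat. \<forall>n\<ge>N. \<forall>k::nat. real n powr (1/3) \<le> real k \<and> k \<le> n \<longrightarrow>
            \<bar>mu n k - 1\<bar> < \<epsilon>"
    using mu_tendsto_1 by blast
qed

end
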